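(* Let $A$ be a C*-algebra. If $\mathcal{C}_{\rightarrowtail}(A)$ has a weak terminal object $D$, then there is an equivalence of categories $\mathcal{C}_{\rightarrowtail}(A)\simeq\mathcal{C}_{\rightarrowtail}(D)$.
   Context: C*-algebras are not required to be unital. For a C*-algebra $A$, $\mathcal{C}_{\rightarrowtail}(A)$ is the category whose objects are the nonzero commutative C*-subalgebras of $A$ and whose morphisms are injective $*$-homomorphisms. An object $D$ is weakly terminal when every object $C$ admits a (not necessarily unique) morphism $C\to D$. *)

theory Defs
  imports Complex_Main "HOL-Library.FuncSet"
begin

section \<open>C*-algebras\<close>

text \<open>
  No unit is required, and the zero algebra is allowed. The real scalar multiplication,
  the norm and completeness come from the superclasses.
\<close>

class cstar_algebra = real_normed_algebra + complete_space +
  fixes scaleC :: "complex \<Rightarrow> 'a \<Rightarrow> 'a"  (infixr "*\<^sub>C" 75)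
    and star :: "'a \<Rightarrow> 'a"
  assumes scaleR_scaleC: "scaleR r x = complex_of_real r *\<^sub>C x"
    and scaleC_add_right: "c *\<^sub>C (x + y) = c *\<^sub>C x + c *\<^sub>C y"
    and scaleC_add_left: "(c + d) *\<^sub>C x = c *\<^sub>C x + d *\<^sub>C x"
    and scaleC_scaleC: "c *\<^sub>C d *\<^sub>C x = (c * d) *\<^sub>C x"
    and mult_scaleC_left: "(c *\<^sub>C x) * y = c *\<^sub>C (x * y)"
    and mult_scaleC_right: "x * (c *\<^sub>C y) = c *\<^sub>C (x * y)"
    and norm_scaleC: "norm (c *\<^sub>C x) = cmod c * norm x"
    and star_star: "star (star x) = x"
    and star_add: "star (x + y) = star x + star y"
    and star_scaleC: "star (c *\<^sub>C x) = cnj c *\<^sub>C star x"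
    and star_mult: "star (x * y) = star y * star x"
    and cstar_identity: "norm (star x * x) = (norm x)\<^sup>2"

definition cstar_subalgebra :: "'a::cstar_algebra set \<Rightarrow> bool" where
  "cstar_subalgebra B \<longleftrightarrow>
     closed B \<and> 0 \<in> B \<and>
     (\<forall>x\<in>B. \<forall>y\<in>B. x + y \<in> B \<and> x * y \<in> B) \<and>
     (\<forall>c. \<forall>x\<in>B. c *\<^sub>C x \<in> B) \<and>
     (\<forall>x\<in>B. star x \<in> B)"

definition star_hom :: "'a::cstar_algebra set \<Rightarrow> 'b::cstar_algebra set \<Rightarrow> ('a \<Rightarrow> 'b) \<Rightarrow> bool" where
  "star_hom B C f \<longleftrightarrow>
     f \<in> B \<rightarrow> C \<and>
     (\<forall>x\<in>B. \<forall>y\<in>B. f (x + y) = f x + f y \<and> f (x * y) = f x * f y) \<and>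
     (\<forall>c. \<forall>x\<in>B. f (c *\<^sub>C x) = c *\<^sub>C f x) \<and>
     (\<forall>x\<in>B. f (star x) = star (f x))"


section \<open>Categories and equivalences\<close>

text \<open>
  A category is given by its objects and a family of hom-sets, which need not be disjoint.
  Hence composition, and the action of a functor on morphisms, take the objects involved
  as explicit arguments: \<open>cmp C X Y Z g f\<close> is the composite of \<open>f : X \<rightarrow> Y\<close> and \<open>g : Y \<rightarrow> Z\<close>.
\<close>

record ('o, 'm) cat =
  obj :: "'o set"
  hom :: "'o \<Rightarrow> 'o \<Rightarrow> 'm set"
  ident :: "'o \<Rightarrow> 'm"
  cmp :: "'o \<Rightarrow> 'o \<Rightarrow> 'o \<Rightarrow> 'm \<Rightarrow> 'm \<Rightarrow> 'm"

locale category =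
  fixes C :: "('o, 'm) cat"
  assumes ident_in_hom: "X \<in> obj C \<Longrightarrow> ident C X \<in> hom C X X"
    and cmp_in_hom: "\<lbrakk>X \<in> obj C; Y \<in> obj C; Z \<in> obj C; f \<in> hom C X Y; g \<in> hom C Y Z\<rbrakk>
      \<Longrightarrow> cmp C X Y Z g f \<in> hom C X Z"
    and cmp_ident_right: "\<lbrakk>X \<in> obj C; Y \<in> obj C; f \<in> hom C X Y\<rbrakk>
      \<Longrightarrow> cmp C X X Y f (ident C X) = f"
    and cmp_ident_left: "\<lbrakk>X \<in> obj C; Y \<in> obj C; f \<in> hom C X Y\<rbrakk>
      \<Longrightarrow> cmp C X Y Y (ident C Y) f = f"
    and cmp_assoc: "\<lbrakk>W \<in> obj C; X \<in> obj C; Y \<in> obj C; Z \<in> obj C;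
        f \<in> hom C W X; g \<in> hom C X Y; h \<in> hom C Y Z\<rbrakk>
      \<Longrightarrow> cmp C W X Z (cmp C X Y Z h g) f = cmp C W Y Z h (cmp C W X Y g f)"

definition weakly_terminal :: "('o, 'm) cat \<Rightarrow> 'o \<Rightarrow> bool" where
  "weakly_terminal C D \<longleftrightarrow> D \<in> obj C \<and> (\<forall>X\<in>obj C. hom C X D \<noteq> {})"

definition iso_in :: "('o, 'm) cat \<Rightarrow> 'o \<Rightarrow> 'o \<Rightarrow> 'm \<Rightarrow> bool" where
  "iso_in C X Y f \<longleftrightarrow>
     f \<in> hom C X Y \<and>
     (\<exists>g\<in>hom C Y X. cmp C X Y X g f = ident C X \<and> cmp C Y X Y f g = ident C Y)"

locale cat_functor = source: category C + target: category D
  for C :: "('o, 'm) cat" and D :: "('p, 'n) cat" +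
  fixes Fo :: "'o \<Rightarrow> 'p" and Fm :: "'o \<Rightarrow> 'o \<Rightarrow> 'm \<Rightarrow> 'n"
  assumes Fo_obj: "X \<in> obj C \<Longrightarrow> Fo X \<in> obj D"
    and Fm_hom: "\<lbrakk>X \<in> obj C; Y \<in> obj C; f \<in> hom C X Y\<rbrakk>
      \<Longrightarrow> Fm X Y f \<in> hom D (Fo X) (Fo Y)"
    and Fm_ident: "X \<in> obj C \<Longrightarrow> Fm X X (ident C X) = ident D (Fo X)"
    and Fm_cmp: "\<lbrakk>X \<in> obj C; Y \<in> obj C; Z \<in> obj C; f \<in> hom C X Y; g \<in> hom C Y Z\<rbrakk>
      \<Longrightarrow> Fm X Z (cmp C X Y Z g f) = cmp D (Fo X) (Fo Y) (Fo Z) (Fm Y Z g) (Fm X Y f)"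

locale natural_iso = F: cat_functor C D Fo Fm + G: cat_functor C D Go Gm
  for C :: "('o, 'm) cat" and D :: "('p, 'n) cat" and Fo Fm Go Gm +
  fixes \<eta> :: "'o \<Rightarrow> 'n"
  assumes component_iso: "X \<in> obj C \<Longrightarrow> iso_in D (Fo X) (Go X) (\<eta> X)"
    and naturality: "\<lbrakk>X \<in> obj C; Y \<in> obj C; f \<in> hom C X Y\<rbrakk>
      \<Longrightarrow> cmp D (Fo X) (Fo Y) (Go Y) (\<eta> Y) (Fm X Y f)
        = cmp D (Fo X) (Go X) (Go Y) (Gm X Y f) (\<eta> X)"

definition equivalent_categories :: "('o, 'm) cat \<Rightarrow> ('p, 'n) cat \<Rightarrow> bool" where
  "equivalent_categories C D \<longleftrightarrow>
     (\<exists>Fo Fm Go Gm \<eta> \<epsilon>.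
        cat_functor C D Fo Fm \<and> cat_functor D C Go Gm \<and>
        natural_iso C C (\<lambda>X. X) (\<lambda>X Y f. f)
          (\<lambda>X. Go (Fo X)) (\<lambda>X Y f. Gm (Fo X) (Fo Y) (Fm X Y f)) \<eta> \<and>
        natural_iso D D (\<lambda>X. Fo (Go X)) (\<lambda>X Y f. Fm (Go X) (Go Y) (Gm X Y f))
          (\<lambda>X. X) (\<lambda>X Y f. f) \<epsilon>)"


section \<open>The category of nonzero commutative C*-subalgebras\<close>

text \<open>
  The algebra \<open>A\<close> is either the whole type or a C*-subalgebra of it; in the latter case its
  C*-subalgebras are exactly the C*-subalgebras of the ambient algebra that lie in \<open>A\<close>.
  Morphisms are extensional functions, so that equality of morphisms is agreement on the
  domain. Neither inclusion-compatibility nor continuity is demanded of them.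
\<close>

definition comm_subalgebra_cat :: "'a::cstar_algebra set \<Rightarrow> ('a set, 'a \<Rightarrow> 'a) cat" where
  "comm_subalgebra_cat A =
     \<lparr>obj = {B. cstar_subalgebra B \<and> B \<subseteq> A \<and> B \<noteq> {0} \<and> (\<forall>x\<in>B. \<forall>y\<in>B. x * y = y * x)},
      hom = (\<lambda>B C. {f \<in> extensional B. star_hom B C f \<and> inj_on f B}),
      ident = (\<lambda>B. \<lambda>x\<in>B. x),
      cmp = (\<lambda>B C E g f. compose B g f)\<rparr>"

lemma category_comm_subalgebra_cat: "category (comm_subalgebra_cat A)"
proof
  fix X assume "X \<in> obj (comm_subalgebra_cat A)"
  then show "ident (comm_subalgebra_cat A) X \<in> hom (comm_subalgebra_cat A) X X"
    by (auto simp: comm_subalgebra_cat_def star_hom_def cstar_subalgebra_def inj_on_def)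
next
  fix X Y Z f g
  assume "X \<in> obj (comm_subalgebra_cat A)"
    and "f \<in> hom (comm_subalgebra_cat A) X Y" "g \<in> hom (comm_subalgebra_cat A) Y Z"
  then show "cmp (comm_subalgebra_cat A) X Y Z g f \<in> hom (comm_subalgebra_cat A) X Z"
    by (auto simp: comm_subalgebra_cat_def star_hom_def cstar_subalgebra_def compose_def
        inj_on_def Pi_iff)
next
  fix X Y f
  assume "f \<in> hom (comm_subalgebra_cat A) X Y"
  then show "cmp (comm_subalgebra_cat A) X X Y f (ident (comm_subalgebra_cat A) X) = f"
    and "cmp (comm_subalgebra_cat A) X Y Y (ident (comm_subalgebra_cat A) Y) f = f"
    by (auto simp: comm_subalgebra_cat_def star_hom_def compose_def Pi_iff
        intro!: extensionalityI[of _ X])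
next
  fix W X Y Z f g h
  assume "f \<in> hom (comm_subalgebra_cat A) W X"
  then show "cmp (comm_subalgebra_cat A) W X Z (cmp (comm_subalgebra_cat A) X Y Z h g) f
      = cmp (comm_subalgebra_cat A) W Y Z h (cmp (comm_subalgebra_cat A) W X Y g f)"
    by (auto simp: comm_subalgebra_cat_def star_hom_def compose_def Pi_iff fun_eq_iff)
qed

end

theory Submission
  imports Defs "HOL-Analysis.Elementary_Topology"
begin

text \<open>
  The inclusion of the category of \<open>D\<close> into that of \<open>A\<close> is full and faithful, because the
  morphisms between two subalgebras do not depend on the algebra around them. It is
  essentially surjective as soon as an injective $*$-homomorphism \<open>f : B \<rightarrow> D\<close> between
  commutative C*-algebras has an image that is again a C*-subalgebra: then weak terminality
  makes every \<open>B\<close> isomorphic to a subalgebra \<open>f ` B\<close> of \<open>D\<close>, and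
  \<open>equivalent_to_full_subcategory\<close> turns this into an equivalence. Only closedness of the
  image is at stake, and it follows once \<open>f\<close> is isometric (\<open>isometric\<close>).

  Isometry is usually read off from the spectrum. The proof here is elementary and uses only
  two tools.

  The first is the inequality \<open>\<parallel>p\<parallel>\<^sup>2 \<le> \<parallel>p\<^sup>* p + q\<^sup>* q\<parallel>\<close> for \<open>p\<^sup>* q = q\<^sup>* p\<close>
  (\<open>norm_sq_le_sum_of_squares\<close>): both \<open>p \<plusminus> \<i>q\<close> have norm \<open>\<surd>\<parallel>p\<^sup>* p + q\<^sup>* q\<parallel>\<close>, and \<open>p\<close> is
  their mean. Thus a sum of squares dominates each summand.

  The second is the existence of square roots of \<open>1 - x\<close> (\<open>quadratic_root\<close>), found by
  iterating \<open>k \<mapsto> (x + k\<^sup>2) / 2\<close>, whose fixed points satisfy \<open>(1 - k)\<^sup>2 = 1 - x\<close>. The iterates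
  are polynomials in \<open>x\<close> with nonnegative coefficients, so for \<open>\<parallel>x\<parallel> \<le> 1\<close> they converge at
  least as fast as the same iteration started with the number \<open>1\<close> for \<open>x\<close>.

  A $*$-homomorphism is contractive: if \<open>h\<close> is self-adjoint of norm at most \<open>1\<close>, then
  \<open>h\<^sup>2 + (1 - k)\<^sup>2 = 1\<close> for some \<open>k\<close>, and this identity survives under \<open>f\<close>, so \<open>\<parallel>f h\<parallel> \<le> 1\<close> by
  the inequality. Conversely let \<open>\<parallel>h\<parallel> = 1\<close> and suppose \<open>r = \<parallel>f h\<parallel>\<^sup>2 < 1\<close>. For \<open>a = h\<^sup>2\<close> the
  element \<open>b = (r a - a\<^sup>2) / 2\<close> is not positive, but \<open>f b\<close> is, so \<open>f b = \<bar>f b\<bar> = f \<bar>b\<bar>\<close>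
  although \<open>b \<noteq> \<bar>b\<bar>\<close>. This contradicts injectivity.
\<close>


section \<open>Sums of squares in a C*-algebra\<close>

lemma star_scaleR: "star (r *\<^sub>R x) = r *\<^sub>R star (x::'a::cstar_algebra)"
  by (simp add: scaleR_scaleC star_scaleC)

lemma star_zero: "star (0::'a::cstar_algebra) = 0"
  using star_scaleR[of 0 "0::'a"] by simp

lemma star_minus: "star (- x) = - star (x::'a::cstar_algebra)"
  using star_scaleR[of "-1" x] by simp

lemma star_diff: "star (x - y) = star x - star (y::'a::cstar_algebra)"
  using star_add[of x "- y"] by (simp add: star_minus)

lemmas star_simps = star_star star_add star_mult star_scaleR star_minus star_diff star_zero

lemma norm_star: "norm (star x) = norm (x::'a::cstar_algebra)"
proof -
  have le: "norm y \<le> norm (star y)" for y :: 'a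
  proof (cases "y = 0")
    case False
    have "norm y * norm y \<le> norm (star y) * norm y"
      using cstar_identity[of y] norm_mult_ineq[of "star y" y] by (simp add: power2_eq_square)
    then show ?thesis using False by simp
  qed simp
  show ?thesis using le[of x] le[of "star x"] by (simp add: star_star)
qed

text \<open>
  The hypothesis makes the cross terms in \<open>(p \<plusminus> \<i>q)\<^sup>* (p \<plusminus> \<i>q)\<close> cancel, so the C*-identity
  gives the norms of \<open>p + \<i>q\<close> and \<open>p - \<i>q\<close>, of which \<open>p\<close> is the mean.
\<close>

lemma norm_sq_le_sum_of_squares:
  fixes p q :: "'a::cstar_algebra"
  assumes "star p * q = star q * p"
  shows "(norm p)\<^sup>2 \<le> norm (star p * p + star q * q)"
proof -
  define S where "S = norm (star p * p + star q * q)"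
  have nrm: "(norm (p + c *\<^sub>C q))\<^sup>2 = S" if "c = \<i> \<or> c = - \<i>" for c
  proof -
    have "star (p + c *\<^sub>C q) * (p + c *\<^sub>C q)
      = star p * p + (cnj c * c) *\<^sub>C (star q * q) + (c + cnj c) *\<^sub>C (star p * q)"
      by (simp add: star_add star_scaleC distrib_left distrib_right mult_scaleC_left
          mult_scaleC_right scaleC_scaleC scaleC_add_left scaleC_add_right assms mult.commute)
    also have "\<dots> = star p * p + (1::real) *\<^sub>R (star q * q) + (0::real) *\<^sub>R (star p * q)"
      using that unfolding scaleR_scaleC by auto
    finally show ?thesis by (simp add: S_def flip: cstar_identity)
  qed
  have root: "norm (p + c *\<^sub>C q) = sqrt S" if "c = \<i> \<or> c = - \<i>" for c
    unfolding nrm[OF that, symmetric] by simp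
  have "(p + \<i> *\<^sub>C q) + (p + (- \<i>) *\<^sub>C q) = 2 *\<^sub>R p + (\<i> + - \<i>) *\<^sub>C q"
    by (simp only: scaleC_add_left scaleR_2) (simp add: algebra_simps)
  also have "\<dots> = 2 *\<^sub>R p + (0::real) *\<^sub>R q"
    unfolding scaleR_scaleC by simp
  finally have "2 * norm p = norm ((p + \<i> *\<^sub>C q) + (p + (- \<i>) *\<^sub>C q))"
    by simp
  also have "\<dots> \<le> norm (p + \<i> *\<^sub>C q) + norm (p + (- \<i>) *\<^sub>C q)"
    by (rule norm_triangle_ineq)
  also have "\<dots> = 2 * sqrt S"
    using root[of \<i>] root[of "- \<i>"] by simp
  finally have "norm p \<le> sqrt S" by simp
  then have "(norm p)\<^sup>2 \<le> (sqrt S)\<^sup>2" by (intro power_mono) auto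
  then show ?thesis by (simp add: S_def)
qed

section \<open>Square roots by a majorized iteration\<close>

text \<open>
  The iteration \<open>k \<mapsto> (x + k\<^sup>2) / 2\<close> for the number \<open>x = 1\<close>, the extreme case of a contraction
  \<open>x\<close>. Its limit \<open>1\<close> is a double root of \<open>2 k = 1 + k\<^sup>2\<close>, so the convergence is not geometric;
  what matters is that it is monotone, which makes the increments summable.
\<close>

primrec majorant :: "nat \<Rightarrow> real" where
  "majorant 0 = 0"
| "majorant (Suc n) = (1 + (majorant n)\<^sup>2) / 2"

lemma majorant_bounds: "0 \<le> majorant n \<and> majorant n \<le> 1"
proof (induction n)
  case (Suc n)
  then have "(majorant n)\<^sup>2 \<le> 1" by (simp add: power_le_one)
  then show ?case by simp
qed simp

lemma incseq_majorant: "incseq majorant"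
proof (rule incseq_SucI)
  fix n
  have "0 \<le> (1 - majorant n)\<^sup>2" by simp
  then show "majorant n \<le> majorant (Suc n)" by (simp add: power2_eq_square algebra_simps)
qed

lemma majorant_tendsto: "majorant \<longlonglongrightarrow> 1"
proof -
  obtain L where L: "majorant \<longlonglongrightarrow> L"
    using incseq_convergent[OF incseq_majorant, of 1] majorant_bounds by blast
  have "(\<lambda>n. majorant (Suc n)) \<longlonglongrightarrow> (1 + L\<^sup>2) / 2"
    by (auto intro!: tendsto_intros L)
  then have "L = (1 + L\<^sup>2) / 2" using LIMSEQ_unique LIMSEQ_Suc[OF L] by blast
  then have "(L - 1)\<^sup>2 = 0" by (simp add: power2_eq_square algebra_simps)
  then show ?thesis using L by simp
qed

locale comm_cstar =
  fixes B :: "'a::cstar_algebra set"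
  assumes subalgebra: "cstar_subalgebra B"
    and commute: "\<lbrakk>x \<in> B; y \<in> B\<rbrakk> \<Longrightarrow> x * y = y * x"
begin

lemma closed_B: "closed B" and zero_B: "0 \<in> B"
  and add_B: "\<lbrakk>x \<in> B; y \<in> B\<rbrakk> \<Longrightarrow> x + y \<in> B"
  and mult_B: "\<lbrakk>x \<in> B; y \<in> B\<rbrakk> \<Longrightarrow> x * y \<in> B"
  and scaleC_B: "x \<in> B \<Longrightarrow> c *\<^sub>C x \<in> B"
  and star_B: "x \<in> B \<Longrightarrow> star x \<in> B"
  using subalgebra by (auto simp: cstar_subalgebra_def)

lemma scaleR_B: "x \<in> B \<Longrightarrow> r *\<^sub>R x \<in> B"
  by (simp add: scaleR_scaleC scaleC_B)

lemma minus_B: "x \<in> B \<Longrightarrow> - x \<in> B"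
  using scaleR_B[of x "-1"] by simp

lemma diff_B: "\<lbrakk>x \<in> B; y \<in> B\<rbrakk> \<Longrightarrow> x - y \<in> B"
  using add_B[of x "- y"] by (simp add: minus_B)

lemmas closure_B = zero_B add_B mult_B scaleC_B scaleR_B star_B minus_B diff_B

lemma left_commute: "\<lbrakk>x \<in> B; y \<in> B\<rbrakk> \<Longrightarrow> x * (y * z) = y * (x * z)"
  using commute[of x y] by (simp flip: mult.assoc)

lemma limit_in_B:
  assumes "\<And>n. u n \<in> B" "u \<longlonglongrightarrow> l"
  shows "l \<in> B"
  using closed_B assms by (rule closed_sequentially)

end

text \<open>
  An element \<open>d + e\<close> of the unitization, with \<open>d\<close> a scalar, is treated through its action
  \<open>z \<mapsto> d z + e z\<close> by left multiplication. A bound for this action controls \<open>e\<close> itself,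
  since \<open>\<parallel>e\<parallel>\<^sup>2 = \<parallel>e e\<^sup>*\<parallel>\<close>.
\<close>

lemma norm_le_of_action_bound:
  fixes e :: "'a::cstar_algebra"
  assumes "\<And>z. norm (d *\<^sub>R z + e * z) \<le> m * norm z" "\<bar>d\<bar> \<le> m"
  shows "norm e \<le> 2 * m"
proof (cases "e = 0")
  case False
  let ?z = "star e"
  have "norm e * norm e = norm (e * ?z)"
    using cstar_identity[of ?z] by (simp add: star_star norm_star power2_eq_square)
  also have "\<dots> = norm ((d *\<^sub>R ?z + e * ?z) - d *\<^sub>R ?z)" by simp
  also have "\<dots> \<le> norm (d *\<^sub>R ?z + e * ?z) + norm (d *\<^sub>R ?z)" by (rule norm_triangle_ineq4)
  also have "\<dots> \<le> m * norm ?z + m * norm ?z"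
    using assms(2) by (intro add_mono assms(1)) (simp add: mult_right_mono)
  also have "\<dots> = (2 * m) * norm e" by (simp add: norm_star)
  finally show ?thesis using False by simp
qed (use assms(2) in simp)

text \<open>
  For \<open>c \<in> {0, 1}\<close> this is the part in the algebra of the iteration \<open>k \<mapsto> ((c + x) + k\<^sup>2) / 2\<close>
  in the unitization: the scalar part of the \<open>n\<close>-th iterate is \<open>c * majorant n\<close>, because
  \<open>c\<^sup>2 = c\<close>.
\<close>

primrec root_iterate :: "real \<Rightarrow> 'a \<Rightarrow> nat \<Rightarrow> 'a::cstar_algebra" where
  "root_iterate c x 0 = 0"
| "root_iterate c x (Suc n) = (1/2) *\<^sub>R (x
    + (2 * c * majorant n) *\<^sub>R root_iterate c x n + root_iterate c x n * root_iterate c x n)"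

context comm_cstar begin

text \<open>
  If \<open>c + x\<close> acts contractively, then the iterates \<open>k\<^sub>n\<close> and their increments
  \<open>k\<^sub>n\<^sub>+\<^sub>1 - k\<^sub>n = (k\<^sub>n + k\<^sub>n\<^sub>-\<^sub>1) (k\<^sub>n - k\<^sub>n\<^sub>-\<^sub>1) / 2\<close> are bounded by those of the majorant, so they
  converge. The limit is \<open>c + y\<close>, as the majorant tends to \<open>1\<close>, and the equation for \<open>y\<close> says
  that \<open>(1 - (c + y))\<^sup>2 = 1 - (c + x)\<close>. The case \<open>c = 0\<close> takes roots of \<open>1 - x\<close> and
  the case \<open>c = 1\<close> takes roots of \<open>- x\<close>.
\<close>

lemma quadratic_root:
  assumes xB: "x \<in> B" and xs: "star x = x" and c: "c = 0 \<or> c = 1"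
    and contr: "\<And>z. norm (c *\<^sub>R z + x * z) \<le> norm z"
  obtains y where "y \<in> B" "star y = y" "2 *\<^sub>R y = x + (2 * c) *\<^sub>R y + y * y"
    "\<And>z. norm (c *\<^sub>R z + y * z) \<le> norm z"
proof -
  define Y where "Y = root_iterate c x"
  have Y0: "Y 0 = 0"
    and YS: "\<And>n. Y (Suc n) = (1/2) *\<^sub>R (x + (2 * c * majorant n) *\<^sub>R Y n + Y n * Y n)"
    by (simp_all add: Y_def)
  \<comment> \<open>The action of the \<open>n\<close>-th iterate in the unitization.\<close>
  define act where "act n z = (c * majorant n) *\<^sub>R z + Y n * z" for n z
  have YB: "Y n \<in> B" for n
    by (induction n) (simp_all add: Y0 YS closure_B xB)
  have Ystar: "star (Y n) = Y n" for n
    by (induction n) (simp_all add: Y0 YS star_simps xs)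
  have actS: "act (Suc n) z = (1/2) *\<^sub>R ((c *\<^sub>R z + x * z) + act n (act n z))" for n z
  proof -
    let ?k = "c * majorant n"
    have "act n (act n z) = (?k * ?k) *\<^sub>R z + (?k *\<^sub>R (Y n * z) + ?k *\<^sub>R (Y n * z))
        + Y n * Y n * z"
      by (simp add: act_def scaleR_add_right distrib_left mult.assoc del: scaleR_scaleR)
         (simp add: mult_ac)
    also have "?k * ?k = c * (majorant n)\<^sup>2"
      using c by (auto simp: power2_eq_square)
    also have "?k *\<^sub>R (Y n * z) + ?k *\<^sub>R (Y n * z) = (2 * c * majorant n) *\<^sub>R (Y n * z)"
      by (simp flip: scaleR_add_left)
    finally show ?thesis
      by (simp add: act_def YS scaleR_add_right distrib_right add_divide_distrib
          scaleR_add_left distrib_left)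
  qed
  have act_le: "norm (act n z) \<le> majorant n * norm z" for n z
  proof (induction n arbitrary: z)
    case 0
    show ?case by (simp add: act_def Y0)
  next
    case (Suc n)
    have "norm (act n (act n z)) \<le> majorant n * norm (act n z)" by (rule Suc)
    also have "\<dots> \<le> majorant n * (majorant n * norm z)"
      using majorant_bounds by (intro mult_left_mono Suc) auto
    finally have "norm ((c *\<^sub>R z + x * z) + act n (act n z))
        \<le> norm z + majorant n * (majorant n * norm z)"
      using contr[of z] norm_triangle_ineq[of "c *\<^sub>R z + x * z" "act n (act n z)"] by linarith
    then have "(1/2) * norm ((c *\<^sub>R z + x * z) + act n (act n z))
        \<le> (1/2) * (norm z + majorant n * (majorant n * norm z))"
      by (rule mult_left_mono) simp
    also have "\<dots> = majorant (Suc n) * norm z"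
      by (simp add: power2_eq_square field_simps)
    finally show ?case unfolding actS by simp
  qed
  have act_commute: "act n (act m z) = act m (act n z)" for n m z
    using left_commute[OF YB[of n] YB[of m], of z]
    by (simp add: act_def distrib_left scaleR_add_right mult_ac)
  have act_sub: "act n (u - v) = act n u - act n v" for n u v
    by (simp add: act_def algebra_simps)
  have diff_le: "norm (act (Suc n) z - act n z)
      \<le> (majorant (Suc n) - majorant n) * norm z" for n z
  proof (induction n arbitrary: z)
    case 0
    have "act (Suc 0) z - act 0 z = (1/2) *\<^sub>R (c *\<^sub>R z + x * z)"
      unfolding actS by (simp add: act_def Y0)
    also have "norm \<dots> = (1/2) * norm (c *\<^sub>R z + x * z)" by simp
    finally show ?case using contr[of z] by simp
  next
    case (Suc n)
    \<comment> \<open>Difference of two squares, which is where commutativity of the iterates enters.\<close>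
    let ?d = "act (Suc n) z - act n z"
    have "act (Suc (Suc n)) z - act (Suc n) z
        = (1/2) *\<^sub>R (act (Suc n) (act (Suc n) z) - act n (act n z))"
      unfolding actS[of "Suc n"] actS[of n z] by (simp add: algebra_simps)
    also have "\<dots> = (1/2) *\<^sub>R (act (Suc n) ?d + act n ?d)"
      unfolding act_sub act_commute[of n "Suc n"] by simp
    also have "norm \<dots> \<le> (1/2) * (majorant (Suc n) * norm ?d + majorant n * norm ?d)"
      using act_le[of "Suc n" ?d] act_le[of n ?d]
        norm_triangle_ineq[of "act (Suc n) ?d" "act n ?d"] by simp
    also have "\<dots> = (majorant (Suc n) + majorant n) / 2 * norm ?d"
      by (simp add: algebra_simps)
    also have "\<dots> \<le> (majorant (Suc n) + majorant n) / 2
        * ((majorant (Suc n) - majorant n) * norm z)"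
      using majorant_bounds[of n] majorant_bounds[of "Suc n"]
      by (intro mult_left_mono Suc) auto
    also have "\<dots> = ((majorant (Suc n))\<^sup>2 - (majorant n)\<^sup>2) / 2 * norm z"
      by (simp add: power2_eq_square field_simps del: majorant.simps)
    also have "\<dots> = (majorant (Suc (Suc n)) - majorant (Suc n)) * norm z"
      using majorant.simps(2)[of n] majorant.simps(2)[of "Suc n"]
      by (simp add: diff_divide_distrib add_divide_distrib del: majorant.simps)
    finally show ?case .
  qed
  have step: "norm (Y (Suc n) - Y n) \<le> 2 * (majorant (Suc n) - majorant n)" for n
  proof (rule norm_le_of_action_bound)
    let ?d = "c * majorant (Suc n) - c * majorant n"
    show "norm (?d *\<^sub>R z + (Y (Suc n) - Y n) * z)
        \<le> (majorant (Suc n) - majorant n) * norm z" for z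
      using diff_le[of n z] by (simp only: act_def algebra_simps)
    show "\<bar>?d\<bar> \<le> majorant (Suc n) - majorant n"
      using c incseqD[OF incseq_majorant, of n "Suc n"] by (auto simp del: majorant.simps)
  qed
  have tail: "norm (Y (n + k) - Y n) \<le> 2 * (majorant (n + k) - majorant n)" for n k
  proof (induction k)
    case (Suc k)
    have "norm (Y (n + Suc k) - Y n) \<le> norm (Y (Suc (n + k)) - Y (n + k)) + norm (Y (n + k) - Y n)"
      using norm_triangle_ineq[of "Y (Suc (n + k)) - Y (n + k)" "Y (n + k) - Y n"]
      by simp
    then show ?case using Suc step[of "n + k"] by (simp del: majorant.simps)
  qed simp
  have "Cauchy Y"
  proof (rule CauchyI')
    fix e :: real assume "0 < e"
    then obtain N where N: "\<bar>majorant n - 1\<bar> < e / 2" if "n \<ge> N" for n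
      using LIMSEQ_D[OF majorant_tendsto, of "e / 2"] by auto
    show "\<exists>M. \<forall>m\<ge>M. \<forall>n>m. dist (Y m) (Y n) < e"
    proof (intro exI[of _ N] allI impI)
      fix m n assume mn: "N \<le> m" "m < n"
      have "dist (Y m) (Y n) = norm (Y n - Y m)" by (simp only: dist_norm norm_minus_commute)
      also have "\<dots> \<le> 2 * (majorant n - majorant m)" using tail[of m "n - m"] mn by simp
      also have "\<dots> \<le> 2 * (1 - majorant m)" using majorant_bounds by simp
      also have "\<dots> \<le> 2 * \<bar>majorant m - 1\<bar>" using abs_ge_minus_self[of "majorant m - 1"] by simp
      also have "\<dots> < e" using N[OF mn(1)] by simp
      finally show "dist (Y m) (Y n) < e" .
    qed
  qed
  then obtain y where lim: "Y \<longlonglongrightarrow> y"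
    using Cauchy_convergent_iff convergent_def by blast
  have "y \<in> B" using YB lim by (rule limit_in_B)
  moreover have "star y = y"
  proof -
    have "norm (star (Y n) - star y) = norm (Y n - y)" for n
      by (simp add: norm_star flip: star_diff)
    then have "(\<lambda>n. star (Y n)) \<longlonglongrightarrow> star y"
      using lim by (simp add: LIMSEQ_iff)
    then have "Y \<longlonglongrightarrow> star y" by (simp add: Ystar)
    then show ?thesis using LIMSEQ_unique lim by blast
  qed
  moreover have "2 *\<^sub>R y = x + (2 * c) *\<^sub>R y + y * y"
  proof -
    have "(\<lambda>n. Y (Suc n)) \<longlonglongrightarrow> (1/2) *\<^sub>R (x + (2 * c * 1) *\<^sub>R y + y * y)"
      unfolding YS by (intro tendsto_intros lim majorant_tendsto)
    then have "y = (1/2) *\<^sub>R (x + (2 * c * 1) *\<^sub>R y + y * y)"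
      using LIMSEQ_unique LIMSEQ_Suc[OF lim] by blast
    then have "2 *\<^sub>R y = 2 *\<^sub>R ((1/2) *\<^sub>R (x + (2 * c * 1) *\<^sub>R y + y * y))" by presburger
    then show ?thesis by simp
  qed
  moreover have "norm (c *\<^sub>R z + y * z) \<le> norm z" for z
  proof (rule LIMSEQ_le_const2)
    show "(\<lambda>n. norm (act n z)) \<longlonglongrightarrow> norm (c *\<^sub>R z + y * z)"
      unfolding act_def using tendsto_mult[OF tendsto_const majorant_tendsto, of c]
      by (auto intro!: tendsto_intros lim)
    show "\<exists>N. \<forall>n\<ge>N. norm (act n z) \<le> norm z"
      using act_le majorant_bounds by (meson mult_left_le_one_le norm_ge_zero order_trans)
  qed
  ultimately show ?thesis by (rule that)
qed

text \<open>
  The hypothesis on \<open>p\<close> expresses positivity together with a bound: \<open>1 - p\<close> acts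
  contractively when \<open>0 \<le> p \<le> 2\<close>. The root inherits it, so roots can be taken repeatedly.
\<close>

lemma square_root:
  assumes "p \<in> B" "star p = p" "\<And>z. norm (z - p * z) \<le> norm z"
  obtains s where "s \<in> B" "star s = s" "s * s = p" "\<And>z. norm (z - s * z) \<le> norm z"
proof -
  obtain y where y: "y \<in> B" "star y = y" "2 *\<^sub>R y = - p + (2 * 1) *\<^sub>R y + y * y"
    "\<And>z. norm (1 *\<^sub>R z + y * z) \<le> norm z"
    using quadratic_root[of "- p" 1] assms by (auto simp: minus_B star_minus)
  show ?thesis
  proof (rule that[of "- y"])
    show "norm (z - (- y) * z) \<le> norm z" for z using y(4)[of z] by simp
  qed (use y in \<open>auto simp: minus_B star_minus algebra_simps\<close>)
qed

text \<open>
  The equation states \<open>h\<^sup>2 + (1 - k)\<^sup>2 = 1\<close> without mentioning a unit.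
\<close>

lemma complementary_root:
  assumes "h \<in> B" "star h = h" "norm h \<le> 1"
  obtains k where "k \<in> B" "star k = k" "2 *\<^sub>R k = h * h + k * k"
proof -
  have "norm (h * h) \<le> 1"
    using assms(3) cstar_identity[of h] by (simp add: assms(2) power_le_one)
  then have "norm (0 *\<^sub>R z + (h * h) * z) \<le> norm z" for z
    using norm_mult_ineq[of "h * h" z] mult_right_mono[of "norm (h * h)" 1 "norm z"] by simp
  from quadratic_root[OF _ _ _ this] assms obtain k where
    "k \<in> B" "star k = k" "2 *\<^sub>R k = h * h + (2 * 0) *\<^sub>R k + k * k"
    by (auto simp: mult_B star_mult)
  then show ?thesis by (intro that[of k]) auto
qed

text \<open>
  Since \<open>h\<^sup>2 + (1 - k)\<^sup>2 = 1\<close>, the sum of squares inequality makes \<open>1 - k\<close> act contractively,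
  and therefore also \<open>(1 - k)\<^sup>2 = 1 - h\<^sup>2\<close>.
\<close>

lemma one_minus_square_contractive:
  assumes h: "h \<in> B" "star h = h" "norm h \<le> 1"
  shows "norm (z - h * h * z) \<le> norm z"
proof -
  obtain k where k: "k \<in> B" "star k = k" "2 *\<^sub>R k = h * h + k * k"
    using complementary_root[OF h] .
  have hh: "h * h = k + k - k * k" using k(3) by (simp add: scaleR_2 algebra_simps)
  have comm: "k * h = h * k" using h k commute by blast
  have root: "norm (z - k * z) \<le> norm z" for z
  proof -
    let ?p = "z - k * z" and ?q = "h * z"
    have "star ?p * ?q = star ?q * ?p"
      by (simp add: star_simps h(2) k(2) algebra_simps) (simp add: comm flip: mult.assoc)
    then have "(norm ?p)\<^sup>2 \<le> norm (star ?p * ?p + star ?q * ?q)"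
      by (rule norm_sq_le_sum_of_squares)
    also have "star ?p * ?p + star ?q * ?q
        = star z * z - star z * (k + k - k * k - h * h) * z"
      by (simp add: star_simps h(2) k(2) algebra_simps)
    also have "\<dots> = star z * z" by (simp add: hh)
    finally have "(norm ?p)\<^sup>2 \<le> (norm z)\<^sup>2" by (simp add: cstar_identity)
    then show ?thesis by (simp add: power2_le_iff_abs_le)
  qed
  have "z - h * h * z = (z - k * z) - k * (z - k * z)"
    by (simp add: hh algebra_simps)
  also have "norm \<dots> \<le> norm z" using order_trans[OF root[of "z - k * z"] root[of z]] .
  finally show ?thesis .
qed

text \<open>
  Here \<open>t\<^sup>2\<close> is \<open>\<bar>b\<bar>\<close>. It is delivered as a square because squares of self-adjoint elements
  are preserved by $*$-homomorphisms for algebraic reasons.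
\<close>

lemma abs_as_square:
  assumes b: "b \<in> B" "star b = b" "norm b \<le> 1"
  obtains t where "t \<in> B" "star t = t" "(t * t) * (t * t) = b * b"
proof -
  obtain s where s: "s \<in> B" "star s = s" "s * s = b * b" "\<And>z. norm (z - s * z) \<le> norm z"
    using square_root[of "b * b"] one_minus_square_contractive[OF b] b
    by (auto simp: mult_B star_mult)
  obtain t where "t \<in> B" "star t = t" "t * t = s"
    using square_root[OF s(1,2,4)] by blast
  then show ?thesis using that[of t] s(3) by simp
qed

text \<open>
  With \<open>d = s\<^sup>2 - t\<^sup>2\<close>, the elements \<open>d s\<close> and \<open>d t\<close> are self-adjoint and their squares sum to
  \<open>d\<^sup>2 (s\<^sup>2 + t\<^sup>2) = d (s\<^sup>4 - t\<^sup>4) = 0\<close>. So both vanish, and then so does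
  \<open>d\<^sup>2 = (d s) s - (d t) t\<close>.
\<close>

lemma positive_root_unique:
  assumes s: "s \<in> B" "star s = s" and t: "t \<in> B" "star t = t"
    and eq: "(s * s) * (s * s) = (t * t) * (t * t)"
  shows "s * s = t * t"
proof -
  define d where "d = s * s - t * t"
  have dB: "d \<in> B" and ds: "star d = d"
    using s t by (auto simp: d_def closure_B star_simps)
  have comm: "d * s = s * d" "d * t = t * d" "s * t = t * s"
    using commute dB s(1) t(1) by blast+
  have vanish: "d * u = 0" if u: "u \<in> B" "star u = u" and v: "v \<in> B" "star v = v"
    and uv: "u * u + v * v = s * s + t * t" for u v
  proof -
    have "star (d * u) * (d * v) = star (d * v) * (d * u)"
      using u v ds dB commute[OF mult_B[OF dB u(1)] mult_B[OF dB v(1)]]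
        commute[of d u] commute[of d v] by (simp add: star_mult)
    then have "(norm (d * u))\<^sup>2 \<le> norm (star (d * u) * (d * u) + star (d * v) * (d * v))"
      by (rule norm_sq_le_sum_of_squares)
    also have "star (d * u) * (d * u) + star (d * v) * (d * v) = (u * u + v * v) * (d * d)"
      using u v ds dB left_commute[of d u] left_commute[of d v] commute[of d u] commute[of d v]
      by (simp add: star_mult distrib_right mult.assoc)
    also have "\<dots> = (s * s + t * t) * d * d" by (simp add: uv mult.assoc)
    also have "(s * s + t * t) * d = (s * s) * (s * s) - (t * t) * (t * t)"
      using commute[of "s * s" "t * t"] s t by (simp add: d_def closure_B algebra_simps)
    also have "\<dots> = 0" by (simp add: eq)
    finally show ?thesis by simp
  qed
  have "d * s = 0" "d * t = 0"
    using vanish[OF s t] vanish[OF t s] by (simp_all add: add.commute)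
  then have "d * d = 0"
    unfolding d_def[symmetric] by (subst (2) d_def) (simp add: right_diff_distrib flip: mult.assoc)
  then have "norm d = 0" using cstar_identity[of d] by (simp add: ds)
  then show ?thesis by (simp add: d_def)
qed

end


section \<open>Injective homomorphisms are isometric\<close>

locale comm_star_hom = B: comm_cstar B + C: comm_cstar C
  for B :: "'a::cstar_algebra set" and C :: "'b::cstar_algebra set" +
  fixes f :: "'a \<Rightarrow> 'b"
  assumes star_hom: "star_hom B C f"
begin

lemma f_in: "x \<in> B \<Longrightarrow> f x \<in> C"
  and f_add: "\<lbrakk>x \<in> B; y \<in> B\<rbrakk> \<Longrightarrow> f (x + y) = f x + f y"
  and f_mult: "\<lbrakk>x \<in> B; y \<in> B\<rbrakk> \<Longrightarrow> f (x * y) = f x * f y"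
  and f_scaleC: "x \<in> B \<Longrightarrow> f (c *\<^sub>C x) = c *\<^sub>C f x"
  and f_star: "x \<in> B \<Longrightarrow> f (star x) = star (f x)"
  using star_hom by (auto simp: star_hom_def)

lemma f_scaleR: "x \<in> B \<Longrightarrow> f (r *\<^sub>R x) = r *\<^sub>R f x"
  by (simp add: scaleR_scaleC f_scaleC)

lemma f_zero: "f 0 = 0"
  using f_scaleR[OF B.zero_B, of 0] by simp

lemma f_minus: "x \<in> B \<Longrightarrow> f (- x) = - f x"
  using f_scaleR[of x "-1"] by simp

lemma f_diff: "\<lbrakk>x \<in> B; y \<in> B\<rbrakk> \<Longrightarrow> f (x - y) = f x - f y"
  using f_add[of x "- y"] by (simp add: B.minus_B f_minus)

text \<open>
  The images \<open>u\<close>, \<open>v\<close> of \<open>h\<close> and its complement \<open>k\<close> satisfy \<open>u\<^sup>2 + (1 - v)\<^sup>2 = 1\<close>. Multiplying by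
  \<open>u\<^sup>2\<close> gives a sum of squares \<open>(u\<^sup>2)\<^sup>2 + (u - v u)\<^sup>2 = u\<^sup>2\<close> inside the algebra, hence
  \<open>\<parallel>u\<^sup>2\<parallel>\<^sup>2 \<le> \<parallel>u\<^sup>2\<parallel>\<close>.
\<close>

lemma norm_image_le_one:
  assumes h: "h \<in> B" "star h = h" "norm h \<le> 1"
  shows "norm (f h) \<le> 1"
proof -
  obtain k where k: "k \<in> B" "star k = k" "2 *\<^sub>R k = h * h + k * k"
    using B.complementary_root[OF h] .
  let ?u = "f h" and ?v = "f k"
  have us: "star ?u = ?u" and vs: "star ?v = ?v"
    using h k by (simp_all flip: f_star)
  have "f (2 *\<^sub>R k) = f (h * h + k * k)" by (simp add: k(3))
  then have uu: "?u * ?u = ?v + ?v - ?v * ?v"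
    using h k by (simp add: f_scaleR f_add f_mult B.mult_B scaleR_2)
  have comm: "?v * ?u = ?u * ?v" using C.commute f_in h(1) k(1) by blast
  have comm': "?v * (?u * z) = ?u * (?v * z)" for z using comm by (simp flip: mult.assoc)
  let ?p = "?u * ?u" and ?q = "?u - ?v * ?u"
  have "star ?p * ?q = star ?q * ?p"
    by (simp add: star_simps us vs algebra_simps comm comm')
  then have "(norm ?p)\<^sup>2 \<le> norm (star ?p * ?p + star ?q * ?q)"
    by (rule norm_sq_le_sum_of_squares)
  also have "star ?p * ?p + star ?q * ?q = ?u * (?u * ?u - (?v + ?v - ?v * ?v)) * ?u + ?u * ?u"
    by (simp add: star_simps us vs algebra_simps comm comm')
  also have "\<dots> = ?u * ?u" by (simp add: uu)
  finally have "norm ?p * norm ?p \<le> 1 * norm ?p" by (simp add: power2_eq_square)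
  then have "norm ?p \<le> 1" by (cases "norm ?p = 0") (auto simp: mult_le_cancel_right)
  then have "(norm ?u)\<^sup>2 \<le> 1" using cstar_identity[of ?u] by (simp add: us)
  then show ?thesis by (simp add: power2_le_iff_abs_le power_le_one_iff)
qed

lemma contractive_selfadjoint:
  assumes "h \<in> B" "star h = h"
  shows "norm (f h) \<le> norm h"
proof (cases "h = 0")
  case False
  have "norm (f (inverse (norm h) *\<^sub>R h)) \<le> 1"
    using assms False by (intro norm_image_le_one) (simp_all add: B.scaleR_B star_scaleR)
  then show ?thesis using assms False by (simp add: f_scaleR field_simps)
qed (simp add: f_zero)

text \<open>
  Suppose \<open>r = \<parallel>f h\<parallel>\<^sup>2 < 1\<close>. On the spectrum, \<open>b = (r a - a\<^sup>2) / 2\<close> with \<open>a = h\<^sup>2\<close> is the function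
  \<open>a (r - a) / 2\<close>, which is nonnegative where \<open>a \<le> r\<close>. This holds throughout the spectrum of
  \<open>f a\<close>, and accordingly \<open>f b\<close> is exhibited as a square \<open>w\<^sup>2\<close>. By uniqueness of positive roots
  it equals \<open>f (t\<^sup>2)\<close>, where \<open>t\<^sup>2 = \<bar>b\<bar>\<close>, and injectivity gives \<open>b = t\<^sup>2\<close>. But then
  \<open>r a = a\<^sup>2 + 2 t\<^sup>2\<close> is a sum of squares dominating \<open>a\<^sup>2\<close>, so \<open>\<parallel>a\<parallel>\<^sup>2 \<le> r \<parallel>a\<parallel>\<close>, although
  \<open>\<parallel>a\<parallel> = 1 > r\<close>.
\<close>

lemma norm_image_ge_one:
  assumes inj: "inj_on f B" and h: "h \<in> B" "star h = h" "norm h = 1"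
  shows "1 \<le> norm (f h)"
proof (rule ccontr)
  assume "\<not> 1 \<le> norm (f h)"
  then have lt: "norm (f h) < 1" by simp
  let ?u = "f h"
  have us: "star ?u = ?u" and uC: "?u \<in> C" using h by (simp_all add: f_in flip: f_star)
  define n where "n = norm ?u"
  define r where "r = n\<^sup>2"
  have "h \<noteq> 0" using h by auto
  then have "?u \<noteq> 0" using inj h f_zero B.zero_B by (metis inj_onD)
  then have n: "0 < n" by (simp add: n_def)
  have r: "0 < r" "r < 1" using n lt by (auto simp: r_def n_def power_less_one_iff abs_square_less_1)
  define a where "a = h * h"
  have a: "a \<in> B" "star a = a" "norm a = 1"
    using h cstar_identity[of h] by (simp_all add: a_def B.mult_B star_mult)
  \<comment> \<open>The factor \<open>1/2\<close> brings \<open>b\<close> into the unit ball, where its absolute value is available.\<close>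
  define b where "b = (1/2) *\<^sub>R (r *\<^sub>R a - a * a)"
  have b: "b \<in> B" "star b = b" using a by (simp_all add: b_def B.closure_B star_simps)
  have "norm (r *\<^sub>R a - a * a) \<le> r * 1 + 1"
    using norm_triangle_ineq4[of "r *\<^sub>R a" "a * a"] norm_mult_ineq[of a a] a r by simp
  then have b1: "norm b \<le> 1" using r by (simp add: b_def)
  obtain t where t: "t \<in> B" "star t = t" "(t * t) * (t * t) = b * b"
    using B.abs_as_square[OF b b1] .
  \<comment> \<open>As \<open>f h / n\<close> has norm \<open>1\<close>, there is \<open>k\<close> with \<open>r - (f h)\<^sup>2 = r (1 - k)\<^sup>2\<close>; multiplying by
    \<open>(f h)\<^sup>2 / 2\<close> shows that \<open>f b\<close> is the square of \<open>w\<close>.\<close>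
  obtain k where k: "k \<in> C" "star k = k"
    "2 *\<^sub>R k = ((1/n) *\<^sub>R ?u) * ((1/n) *\<^sub>R ?u) + k * k"
    using C.complementary_root[of "(1/n) *\<^sub>R ?u"] us uC n
    by (auto simp: C.scaleR_B star_scaleR n_def)
  define w where "w = (n / sqrt 2) *\<^sub>R (?u - k * ?u)"
  have comm: "k * ?u = ?u * k" using C.commute uC k(1) by blast
  have comm': "k * (?u * z) = ?u * (k * z)" for z using comm by (simp flip: mult.assoc)
  have w: "w \<in> C" "star w = w"
    using uC k us by (simp_all add: w_def C.closure_B star_simps comm)
  define K where "K = k + k - k * k"
  have uu: "?u * ?u = r *\<^sub>R K"
  proof -
    have "r *\<^sub>R (2 *\<^sub>R k) = ?u * ?u + r *\<^sub>R (k * k)"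
      unfolding k(3) using n by (simp add: scaleR_add_right r_def power2_eq_square)
    then show ?thesis by (simp add: K_def algebra_simps scaleR_2)
  qed
  have ww: "w * w = f b"
  proof -
    have "w * w = (n / sqrt 2 * (n / sqrt 2)) *\<^sub>R ((?u - k * ?u) * (?u - k * ?u))"
      by (simp add: w_def)
    also have "n / sqrt 2 * (n / sqrt 2) = r / 2" by (simp add: r_def power2_eq_square)
    also have "(?u - k * ?u) * (?u - k * ?u) = ?u * ?u - ?u * K * ?u"
      by (simp add: K_def comm comm' algebra_simps)
    also have "(r / 2) *\<^sub>R \<dots> = (1/2) *\<^sub>R (r *\<^sub>R (?u * ?u) - ?u * (r *\<^sub>R K) * ?u)"
      by (simp add: scaleR_diff_right)
    also have "\<dots> = (1/2) *\<^sub>R (r *\<^sub>R (?u * ?u) - (?u * ?u) * (?u * ?u))"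
      by (simp add: mult.assoc flip: uu)
    also have "\<dots> = f b"
    proof -
      have "f a = ?u * ?u" using h by (simp add: a_def f_mult)
      then show ?thesis
        using a by (simp add: b_def f_scaleR f_diff f_mult B.closure_B)
    qed
    finally show ?thesis .
  qed
  have "(f t * f t) * (f t * f t) = (w * w) * (w * w)"
    using t(1) b(1) f_mult[of "t * t" "t * t"] f_mult[of b b] unfolding ww t(3)
    by (simp add: B.mult_B f_mult)
  then have "f t * f t = w * w"
    using C.positive_root_unique[of "f t" w] t w by (simp add: f_in flip: f_star)
  then have "f (t * t) = f b" using t by (simp add: ww f_mult)
  then have tb: "t * t = b" using inj t b B.mult_B by (meson inj_onD)
  let ?q = "sqrt 2 *\<^sub>R t"
  have "star a * ?q = star ?q * a"
    using a t B.commute[of a t] by (simp add: star_scaleR)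
  then have "(norm a)\<^sup>2 \<le> norm (star a * a + star ?q * ?q)"
    by (rule norm_sq_le_sum_of_squares)
  also have "star a * a + star ?q * ?q = r *\<^sub>R a"
    using a t by (simp add: star_scaleR tb) (simp add: b_def)
  also have "norm \<dots> < 1" using a r by simp
  finally show False using a by simp
qed

lemma isometric:
  assumes inj: "inj_on f B" and x: "x \<in> B"
  shows "norm (f x) = norm x"
proof -
  have sa: "norm (f h) = norm h" if h: "h \<in> B" "star h = h" for h
  proof (cases "h = 0")
    case False
    have "1 \<le> norm (f (inverse (norm h) *\<^sub>R h))"
      using h False by (intro norm_image_ge_one inj) (simp_all add: B.scaleR_B star_scaleR)
    then have "norm h \<le> norm (f h)" using h False by (simp add: f_scaleR field_simps)
    then show ?thesis using contractive_selfadjoint[OF h] by simp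
  qed (simp add: f_zero)
  have "(norm (f x))\<^sup>2 = norm (f (star x * x))"
    using x by (simp add: f_mult f_star B.star_B cstar_identity)
  also have "\<dots> = (norm x)\<^sup>2"
    using x by (simp add: sa B.closure_B star_simps cstar_identity)
  finally show ?thesis by simp
qed

lemma cstar_subalgebra_image:
  assumes inj: "inj_on f B"
  shows "cstar_subalgebra (f ` B)"
proof -
  have "closed (f ` B)"
    unfolding closed_sequential_limits
  proof (intro allI impI, elim conjE)
    fix y l assume "\<forall>n. y n \<in> f ` B" and yl: "y \<longlonglongrightarrow> l"
    then have "\<forall>n. \<exists>x\<in>B. y n = f x" by blast
    then obtain x where x: "\<And>n. x n \<in> B" "\<And>n. y n = f (x n)" by metis
    have dist: "dist (f u) (f v) = dist u v" if "u \<in> B" "v \<in> B" for u v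
      using that isometric[OF inj, of "u - v"] by (simp add: dist_norm f_diff B.diff_B)
    have "Cauchy y" using yl by (rule LIMSEQ_imp_Cauchy)
    moreover have "dist (y m) (y n) = dist (x m) (x n)" for m n
      unfolding x(2) by (intro dist x(1))
    ultimately have "Cauchy x" by (simp add: Cauchy_def)
    then obtain x0 where lim: "x \<longlonglongrightarrow> x0"
      using Cauchy_convergent_iff convergent_def by blast
    then have x0: "x0 \<in> B" using x(1) B.limit_in_B by blast
    have "dist (y n) (f x0) = dist (x n) x0" for n
      unfolding x(2) by (intro dist x(1) x0)
    then have "y \<longlonglongrightarrow> f x0" using lim by (simp add: lim_sequentially)
    then show "l \<in> f ` B" using LIMSEQ_unique[OF yl] x0 by blast
  qed
  moreover have "0 \<in> f ` B" using f_zero B.zero_B by force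
  moreover have "u + v \<in> f ` B \<and> u * v \<in> f ` B" if "u \<in> f ` B" "v \<in> f ` B" for u v
    using that B.add_B B.mult_B by (auto simp flip: f_add f_mult)
  moreover have "c *\<^sub>C u \<in> f ` B \<and> star u \<in> f ` B" if "u \<in> f ` B" for c u
    using that B.scaleC_B B.star_B by (auto simp flip: f_scaleC f_star)
  ultimately show ?thesis unfolding cstar_subalgebra_def by blast
qed

lemma star_hom_image: "star_hom B (f ` B) f"
  using star_hom by (auto simp: star_hom_def)

lemma star_hom_inverse:
  assumes inj: "inj_on f B"
  shows "star_hom (f ` B) B (restrict (inv_into B f) (f ` B))"
proof -
  define g where "g = restrict (inv_into B f) (f ` B)"
  have g: "g (f x) = x" if "x \<in> B" for x using inj that by (simp add: g_def)
  have "g (f x + f y) = x + y \<and> g (f x * f y) = x * y" if "x \<in> B" "y \<in> B" for x y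
    using that g[of "x + y"] g[of "x * y"] by (simp add: B.add_B B.mult_B f_add f_mult)
  moreover have "g (c *\<^sub>C f x) = c *\<^sub>C x \<and> g (star (f x)) = star x" if "x \<in> B" for c x
    using that g[of "c *\<^sub>C x"] g[of "star x"] by (simp add: B.scaleC_B B.star_B f_scaleC f_star)
  ultimately show ?thesis
    unfolding star_hom_def g_def[symmetric] by (simp add: Pi_iff g)
qed

end


section \<open>Equivalence with a full subcategory\<close>

text \<open>
  Choose for each \<open>X\<close> an isomorphism \<open>u X\<close> onto an object \<open>R X\<close> in \<open>S\<close>, with inverse \<open>v X\<close>.
  Conjugation by these makes \<open>R\<close> a functor, inverse to the inclusion, with \<open>u\<close> and \<open>v\<close> as
  unit and counit.
\<close>

lemma (in category) equivalent_to_full_subcategory: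
  assumes sub: "S \<subseteq> obj C"
    and dense: "\<And>X. X \<in> obj C \<Longrightarrow> \<exists>Y\<in>S. \<exists>f. iso_in C X Y f"
  shows "equivalent_categories C (C\<lparr>obj := S\<rparr>)"
proof -
  let ?S = "C\<lparr>obj := S\<rparr>"
  have "\<forall>X\<in>obj C. \<exists>Y u v. Y \<in> S \<and> u \<in> hom C X Y \<and> v \<in> hom C Y X
      \<and> cmp C X Y X v u = ident C X \<and> cmp C Y X Y u v = ident C Y"
    using dense unfolding iso_in_def by blast
  then obtain R u v where RS: "\<And>X. X \<in> obj C \<Longrightarrow> R X \<in> S"
    and u: "\<And>X. X \<in> obj C \<Longrightarrow> u X \<in> hom C X (R X)"
    and v: "\<And>X. X \<in> obj C \<Longrightarrow> v X \<in> hom C (R X) X"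
    and vu: "\<And>X. X \<in> obj C \<Longrightarrow> cmp C X (R X) X (v X) (u X) = ident C X"
    and uv: "\<And>X. X \<in> obj C \<Longrightarrow> cmp C (R X) X (R X) (u X) (v X) = ident C (R X)"
    by metis
  have SC: "\<And>X. X \<in> S \<Longrightarrow> X \<in> obj C" using sub by blast
  have RC: "\<And>X. X \<in> obj C \<Longrightarrow> R X \<in> obj C" using RS SC by blast
  define F where "F X Y f = cmp C (R X) X (R Y) (cmp C X Y (R Y) (u Y) f) (v X)" for X Y f
  note closed = cmp_in_hom u v RC ident_in_hom
  have F_hom: "F X Y f \<in> hom C (R X) (R Y)"
    if "X \<in> obj C" "Y \<in> obj C" "f \<in> hom C X Y" for X Y f
    unfolding F_def using that by (intro closed)
  have F_u: "cmp C X (R X) (R Y) (F X Y f) (u X) = cmp C X Y (R Y) (u Y) f"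
    if "X \<in> obj C" "Y \<in> obj C" "f \<in> hom C X Y" for X Y f
  proof -
    have "cmp C X (R X) (R Y) (F X Y f) (u X)
        = cmp C X X (R Y) (cmp C X Y (R Y) (u Y) f) (cmp C X (R X) X (v X) (u X))"
      unfolding F_def using that by (intro cmp_assoc closed)
    then show ?thesis using that by (simp add: vu cmp_ident_right closed)
  qed
  have F_ident: "F X X (ident C X) = ident C (R X)" if "X \<in> obj C" for X
    using that by (simp add: F_def cmp_ident_right closed uv)
  have F_cmp: "F X Z (cmp C X Y Z g f) = cmp C (R X) (R Y) (R Z) (F Y Z g) (F X Y f)"
    if X: "X \<in> obj C" and Y: "Y \<in> obj C" and Z: "Z \<in> obj C"
      and f: "f \<in> hom C X Y" and g: "g \<in> hom C Y Z" for X Y Z f g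
  proof -
    note typing = X Y Z f g F_hom closed
    have "cmp C (R X) (R Y) (R Z) (F Y Z g) (F X Y f)
        = cmp C (R X) X (R Z) (cmp C X (R Y) (R Z) (F Y Z g) (cmp C X Y (R Y) (u Y) f)) (v X)"
      unfolding F_def[of X Y] by (rule cmp_assoc[symmetric]) (intro typing)+
    also have "cmp C X (R Y) (R Z) (F Y Z g) (cmp C X Y (R Y) (u Y) f)
        = cmp C X Y (R Z) (cmp C Y (R Y) (R Z) (F Y Z g) (u Y)) f"
      by (rule cmp_assoc[symmetric]) (intro typing)+
    also have "\<dots> = cmp C X Y (R Z) (cmp C Y Z (R Z) (u Z) g) f"
      by (simp add: F_u[OF Y Z g])
    also have "\<dots> = cmp C X Z (R Z) (u Z) (cmp C X Y Z g f)"
      by (rule cmp_assoc) (intro typing)+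
    finally show ?thesis by (simp add: F_def)
  qed
  have catS: "category ?S"
    by unfold_locales (simp_all add: SC ident_in_hom cmp_in_hom cmp_ident_left cmp_ident_right
        cmp_assoc[symmetric])
  have functorF: "cat_functor C ?S R F"
    by (intro cat_functor.intro cat_functor_axioms.intro catS category_axioms)
      (simp_all add: RS F_hom F_ident F_cmp)
  have functorI: "cat_functor ?S C (\<lambda>X. X) (\<lambda>X Y f. f)"
    by (intro cat_functor.intro cat_functor_axioms.intro catS category_axioms) (simp_all add: SC)
  have functorFC: "cat_functor C C R F"
    by (intro cat_functor.intro cat_functor_axioms.intro category_axioms)
      (simp_all add: RC F_hom F_ident F_cmp)
  have functorFS: "cat_functor ?S ?S R F"
    by (intro cat_functor.intro cat_functor_axioms.intro catS)
      (simp_all add: SC RS F_hom F_ident F_cmp)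
  have functor_id: "cat_functor D D (\<lambda>X. X) (\<lambda>X Y f. f)" if "category D" for D :: "('a, 'b) cat"
    using that by (intro cat_functor.intro cat_functor_axioms.intro) auto
  have F_v: "cmp C (R X) (R Y) Y (v Y) (F X Y f) = cmp C (R X) X Y f (v X)"
    if X: "X \<in> obj C" and Y: "Y \<in> obj C" and f: "f \<in> hom C X Y" for X Y f
  proof -
    note typing = X Y f F_hom closed
    have "cmp C (R X) (R Y) Y (v Y) (F X Y f)
        = cmp C (R X) X Y (cmp C X (R Y) Y (v Y) (cmp C X Y (R Y) (u Y) f)) (v X)"
      unfolding F_def by (rule cmp_assoc[symmetric]) (intro typing)+
    also have "cmp C X (R Y) Y (v Y) (cmp C X Y (R Y) (u Y) f)
        = cmp C X Y Y (cmp C Y (R Y) Y (v Y) (u Y)) f"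
      by (rule cmp_assoc[symmetric]) (intro typing)+
    also have "\<dots> = f" by (simp add: vu cmp_ident_left X Y f)
    finally show ?thesis .
  qed
  have unit: "natural_iso C C (\<lambda>X. X) (\<lambda>X Y f. f) R F u"
    by (intro natural_iso.intro natural_iso_axioms.intro functor_id functorFC category_axioms)
      (auto simp: iso_in_def F_u u intro!: bexI[of _ "v _"] v vu uv)
  have counit: "natural_iso ?S ?S R F (\<lambda>X. X) (\<lambda>X Y f. f) v"
    by (intro natural_iso.intro natural_iso_axioms.intro functor_id functorFS catS)
      (auto simp: SC iso_in_def F_v v intro!: bexI[of _ "u _"] u vu uv)
  show ?thesis
    unfolding equivalent_categories_def using functorF functorI unit counit by blast
qed


section \<open>Commutative subalgebras\<close>

text \<open>
  A morphism corestricts to an isomorphism onto its image, since the image is closed.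
\<close>

lemma iso_in_comm_subalgebra_cat_image:
  fixes A :: "'a::cstar_algebra set"
  assumes B: "B \<in> obj (comm_subalgebra_cat A)" and D: "D \<in> obj (comm_subalgebra_cat A)"
    and f: "f \<in> hom (comm_subalgebra_cat A) B D"
  shows "f ` B \<in> obj (comm_subalgebra_cat D)" and "iso_in (comm_subalgebra_cat A) B (f ` B) f"
proof -
  have ext: "f \<in> extensional B" and inj: "inj_on f B"
    using f by (auto simp: comm_subalgebra_cat_def)
  interpret comm_star_hom B D f
    using B D f by unfold_locales (auto simp: comm_subalgebra_cat_def)
  have "f ` B \<noteq> {0}"
  proof
    assume "f ` B = {0}"
    then have "x = 0" if "x \<in> B" for x
      using inj_onD[OF inj, of x 0] f_zero B.zero_B that by auto
    then show False using B B.zero_B by (auto simp: comm_subalgebra_cat_def)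
  qed
  then show "f ` B \<in> obj (comm_subalgebra_cat D)"
    using cstar_subalgebra_image[OF inj] f_in C.commute
    by (auto simp: comm_subalgebra_cat_def simp del: image_is_empty)
  let ?g = "restrict (inv_into B f) (f ` B)"
  have "inj_on ?g (f ` B)" by (simp add: inj_on_inv_into inj_on_restrict_eq)
  then have "?g \<in> hom (comm_subalgebra_cat A) (f ` B) B"
    using star_hom_inverse[OF inj] by (simp add: comm_subalgebra_cat_def)
  moreover have "f \<in> hom (comm_subalgebra_cat A) B (f ` B)"
    using star_hom_image ext inj by (simp add: comm_subalgebra_cat_def)
  moreover have "compose B ?g f = restrict (\<lambda>x. x) B"
    "compose (f ` B) f ?g = restrict (\<lambda>x. x) (f ` B)"
    using inj by (auto simp: compose_def fun_eq_iff)
  ultimately show "iso_in (comm_subalgebra_cat A) B (f ` B) f"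
    unfolding iso_in_def by (auto simp: comm_subalgebra_cat_def)
qed

theorem lemma4p4:
  fixes D :: "'a::cstar_algebra set"
  assumes "weakly_terminal (comm_subalgebra_cat (UNIV :: 'a set)) D"
  shows "equivalent_categories (comm_subalgebra_cat (UNIV :: 'a set)) (comm_subalgebra_cat D)"
proof -
  let ?A = "comm_subalgebra_cat (UNIV :: 'a set)" and ?S = "obj (comm_subalgebra_cat D)"
  have full: "comm_subalgebra_cat D = ?A\<lparr>obj := ?S\<rparr>"
    by (simp add: comm_subalgebra_cat_def)
  have "equivalent_categories ?A (?A\<lparr>obj := ?S\<rparr>)"
  proof (rule category.equivalent_to_full_subcategory[OF category_comm_subalgebra_cat])
    show "?S \<subseteq> obj ?A" by (auto simp: comm_subalgebra_cat_def)
    fix X assume X: "X \<in> obj ?A"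
    have D: "D \<in> obj ?A" and "hom ?A X D \<noteq> {}"
      using assms X by (auto simp: weakly_terminal_def)
    then obtain f where "f \<in> hom ?A X D" by blast
    from iso_in_comm_subalgebra_cat_image[OF X D this]
    show "\<exists>Y\<in>?S. \<exists>f. iso_in ?A X Y f" by blast
  qed
  then show ?thesis by (simp flip: full)
qed

end
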